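(* Let $X$ and $Y$ be compact metric spaces and let $\pi:X\to Y$ be a continuous surjection which is semiopen. Then the induced map $\pi_*:\mathfrak{M}(X)\to\mathfrak{M}(Y)$ is a semiopen surjection.
   Context: A continuous map between topological spaces is called semiopen if the image of every nonempty open set has nonempty interior. For a compact metric space $X$, $\mathfrak{M}(X)$ denotes the space of Borel probability measures on $X$ with the weak$^*$ topology (from $C(X)^*$), and $\pi_*$ denotes push-forward of measures: $\pi_*(\mu)(B)=\mu(\pi^{-1}(B))$. *)

theory Defs
  imports "HOL-Probability.Probability"
begin

definition semiopen_map :: "'a topology \<Rightarrow> 'b topology \<Rightarrow> ('a \<Rightarrow> 'b) \<Rightarrow> bool" where
  "semiopen_map S T f \<longleftrightarrow>
     continuous_map S T f \<and> (\<forall>U. openin S U \<and> U \<noteq> {} \<longrightarrow> T interior_of (f ` U) \<noteq> {})"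

(* A space is a subset X of a metric space type. Its Borel sigma-algebra is that of
   restrict_space borel X, so every \<mu> in borel_prob_measures X has space \<mu> = X. *)
definition borel_prob_measures :: "'a::metric_space set \<Rightarrow> 'a measure set" where
  "borel_prob_measures X = {\<mu>. prob_space \<mu> \<and> sets \<mu> = sets (restrict_space borel X)}"

(* The coarsest topology on borel_prob_measures X for which \<mu> \<mapsto> \<integral> f d\<mu> is continuous for each
   f in C(X). Values of f off X do not matter, because space \<mu> = X. *)
definition weak_star_topology :: "'a::metric_space set \<Rightarrow> 'a measure topology" where
  "weak_star_topology X = topology_generated_by
     {{\<mu> \<in> borel_prob_measures X. integral\<^sup>L \<mu> f \<in> V} | (f :: 'a \<Rightarrow> real) V.
        continuous_on X f \<and> open V}"

lemma topspace_weak_star_topology [simp]: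
  "topspace (weak_star_topology X) = borel_prob_measures X"
proof -
  have "\<exists>(f :: 'a \<Rightarrow> real) V. borel_prob_measures X = {\<mu> \<in> borel_prob_measures X. integral\<^sup>L \<mu> f \<in> V}
      \<and> continuous_on X f \<and> open V"
    by (rule exI[of _ "\<lambda>_. 0"], rule exI[of _ UNIV]) auto
  then show ?thesis
    unfolding weak_star_topology_def topology_generated_by_topspace by blast
qed

definition push_forward ::
  "'b::metric_space set \<Rightarrow> ('a::metric_space \<Rightarrow> 'b) \<Rightarrow> 'a measure \<Rightarrow> 'b measure" where
  "push_forward Y \<pi> \<mu> = distr \<mu> (restrict_space borel Y) \<pi>"

end

(* Measures lift along \<pi> because a continuous surjection of compact metric spaces has a Borel
   section. For semiopenness, let U be a weak-star neighbourhood of \<mu>0. Discretise \<mu>0 to a measure with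
   weights a c at finitely many points c of X, and pick y c in the interior of the image of a small
   ball around c. A measure \<nu> close to the sum of the a c \<delta>(y c) has almost all its mass near the
   points y c; lift the mass near y c by a section with values in the small ball around c, and the
   small rest by any section. The lift is close to \<mu>0, so a neighbourhood of that discrete measure
   lies in the image of U. The points y c may coincide (for instance when Y has isolated
   points), and then the mass near the common point is split in proportion to the a c. *)
theory Submission
  imports Defs
begin

section \<open>Measurable sections\<close>

text \<open>Total boundedness provides finite nets of arbitrarily small mesh, and the closed balls
  around their points form a countable family. A ball that contains \<open>u\<close> and has radius
  below \<open>dist u v / 2\<close> cannot reach \<open>v\<close>.\<close>

lemma compact_countable_separating:
  fixes X :: "'a::metric_space set"
  assumes "compact X"
  obtains C :: "nat \<Rightarrow> 'a set"
  where "\<And>n. closed (C n)"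
    and "\<And>u v. u \<in> X \<Longrightarrow> v \<in> X \<Longrightarrow> u \<noteq> v \<Longrightarrow> \<exists>n. u \<in> C n \<and> v \<notin> C n"
proof -
  have "\<exists>F. finite F \<and> F \<subseteq> X \<and> X \<subseteq> (\<Union>c\<in>F. ball c (inverse (real (Suc n))))" for n
    using seq_compact_imp_totally_bounded[OF assms[unfolded compact_eq_seq_compact_metric]]
    by (auto simp del: of_nat_Suc)
  then obtain F where F: "\<And>n. finite (F n)" "\<And>n. X \<subseteq> (\<Union>c\<in>F n. ball c (inverse (real (Suc n))))"
    by metis
  \<comment> \<open>\<open>UNIV\<close> keeps the family nonempty, hence enumerable by the naturals,
    even if all the nets are empty.\<close>
  define \<C> where "\<C> = insert UNIV (\<Union>n. (\<lambda>c. cball c (inverse (real (Suc n)))) ` F n)"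
  have "countable \<C>" "\<C> \<noteq> {}" unfolding \<C>_def using F(1) by (auto intro: countable_finite)
  then obtain C :: "nat \<Rightarrow> 'a set" where C: "range C = \<C>" by (metis range_from_nat_into)
  show thesis
  proof
    show "closed (C n)" for n
    proof -
      have "C n \<in> \<C>" using C by auto
      then show ?thesis unfolding \<C>_def by auto
    qed
    fix u v assume uv: "u \<in> X" "v \<in> X" "u \<noteq> v"
    then obtain n where n: "inverse (real (Suc n)) < dist u v / 2"
      using reals_Archimedean[of "dist u v / 2"] by auto
    obtain c where c: "c \<in> F n" "u \<in> ball c (inverse (real (Suc n)))" using F(2)[of n] uv by blast
    have "cball c (inverse (real (Suc n))) \<in> range C" using c(1) C unfolding \<C>_def by blast
    then obtain m where m: "C m = cball c (inverse (real (Suc n)))" by auto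
    have "v \<notin> C m"
      using c(2) n dist_triangle[of u v c] by (auto simp: m dist_commute simp del: of_nat_Suc)
    then show "\<exists>n. u \<in> C n \<and> v \<notin> C n" using c(2) m by (metis ball_subset_cball subsetD)
  qed
qed

text \<open>A Borel selection from the compact fibres of \<pi>. The set \<open>D\<close> expresses a
  preference: wherever the fibre meets \<open>D\<close>, the selected point lies in
  \<open>D\<close>. With a small closed ball as \<open>D\<close>, this yields lifts concentrated
  near a prescribed point.\<close>

lemma measurable_section:
  fixes X D :: "'a::metric_space set" and \<pi> :: "'a \<Rightarrow> 'b::metric_space"
  assumes X: "compact X" and \<pi>: "continuous_on X \<pi>" and D: "closed D"
  obtains s where "s \<in> restrict_space borel (\<pi> ` X) \<rightarrow>\<^sub>M restrict_space borel X"
    and "\<And>y. y \<in> \<pi> ` X \<Longrightarrow> s y \<in> X \<and> \<pi> (s y) = y"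
    and "\<And>y. y \<in> \<pi> ` (X \<inter> D) \<Longrightarrow> s y \<in> D"
proof -
  obtain C0 :: "nat \<Rightarrow> 'a set" where C0: "\<And>n. closed (C0 n)"
    "\<And>u v. u \<in> X \<Longrightarrow> v \<in> X \<Longrightarrow> u \<noteq> v \<Longrightarrow> \<exists>n. u \<in> C0 n \<and> v \<notin> C0 n"
    using compact_countable_separating[OF X] by blast
  (* Shrink the fibre over y successively by the sets C n, as long as it stays nonempty. The C n
     separate points, so a single point remains; D comes first and hence is preferred. *)
  define C where "C = case_nat D C0"
  have C: "closed (C n)" for n using C0(1) D by (auto simp: C_def split: nat.split)
  define K where "K = rec_nat (\<lambda>y. {x \<in> X. \<pi> x = y})
    (\<lambda>n Kn y. if Kn y \<inter> C n = {} then Kn y else Kn y \<inter> C n)"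
  have K0: "K 0 y = {x \<in> X. \<pi> x = y}" for y by (simp add: K_def)
  have KS: "K (Suc n) y = (if K n y \<inter> C n = {} then K n y else K n y \<inter> C n)" for n y
    by (simp add: K_def)
  have closedK0: "closed (K 0 y)" for y
  proof -
    have "{x \<in> X. \<pi> x = y} = X \<inter> \<pi> -` {y}" by auto
    then show ?thesis
      unfolding K0 using continuous_closed_preimage[OF \<pi> compact_imp_closed[OF X], of "{y}"] by simp
  qed
  have closedK: "closed (K n y)" for n y
    by (induction n) (use closedK0 C in \<open>auto simp: KS\<close>)
  have neK: "K n y \<noteq> {}" if "y \<in> \<pi> ` X" for n y
    by (induction n) (use that in \<open>auto simp: K0 KS\<close>)
  have decK: "m \<le> n \<Longrightarrow> K n y \<subseteq> K m y" for m n y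
    by (rule lift_Suc_antimono_le[of "\<lambda>n. K n y"]) (auto simp: KS)
  have KX: "K n y \<subseteq> X" for n y using decK[of 0 n y] by (auto simp: K0)
  \<comment> \<open>Compactness: if all the nested closed stages meet \<open>E\<close>, they have a
    common point in \<open>E\<close>. Taking \<open>E = UNIV\<close> gives a surviving point;
    general \<open>E\<close> serves for measurability.\<close>
  have nest: "X \<inter> (\<Inter>n. K n y \<inter> E) \<noteq> {}" if "\<And>n. K n y \<inter> E \<noteq> {}" "closed E" for y E
  proof (rule compact_imp_fip_image[OF X])
    fix I :: "nat set" assume "finite I" 
    then obtain m where m: "\<And>i. i \<in> I \<Longrightarrow> i \<le> m" by (meson Max_ge)
    have "K m y \<inter> E \<subseteq> X \<inter> (\<Inter>n\<in>I. K n y \<inter> E)" using m decK KX by blast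
    then show "X \<inter> (\<Inter>n\<in>I. K n y \<inter> E) \<noteq> {}" using that(1)[of m] by blast
  qed (use closedK that in auto)
  define s where "s y = (SOME x. \<forall>n. x \<in> K n y)" for y
  have sK: "s y \<in> K n y" if "y \<in> \<pi> ` X" for n y
  proof -
    have "\<exists>x. \<forall>n. x \<in> K n y" using nest[of y UNIV] neK[OF that] by auto
    from someI_ex[OF this] show ?thesis by (simp add: s_def)
  qed
  \<comment> \<open>If stage \<open>n\<close> still meets \<open>C n\<close>, the next stage lies
    inside \<open>C n\<close>, and \<open>s y\<close> belongs to every stage.\<close>
  have KC: "s y \<in> C n" if "y \<in> \<pi> ` X" "x \<in> K n y" "x \<in> C n" for n x y
    using sK[OF that(1), of "Suc n"] that(2,3) by (auto simp: KS split: if_splits)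
  have uniq: "x = s y" if y: "y \<in> \<pi> ` X" and x: "\<And>n. x \<in> K n y" for x y
  proof (rule ccontr)
    assume "x \<noteq> s y"
    moreover have "x \<in> X" "s y \<in> X" using x[of 0] sK[OF y, of 0] by (auto simp: K0)
    ultimately obtain n where "x \<in> C0 n" "s y \<notin> C0 n" using C0(2) by blast
    \<comment> \<open>\<open>D\<close> occupies index 0, so \<open>C0 n\<close> has index
      \<open>Suc n\<close>.\<close>
    then have "x \<in> C (Suc n)" "s y \<notin> C (Suc n)" by (auto simp: C_def)
    with KC[OF y x] show False by blast
  qed
  \<comment> \<open>At stage 0 the set in question is the compact image of
    \<open>X \<inter> E\<close>. At a successor it is a Boolean combination of the sets for
    \<open>C n \<inter> E\<close>, \<open>E\<close> and \<open>C n\<close>, so the induction treats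
    all closed \<open>E\<close> together.\<close>
  have meas: "\<And>E. closed E \<Longrightarrow> {y \<in> \<pi> ` X. K n y \<inter> E \<noteq> {}} \<in> sets (restrict_space borel (\<pi> ` X))" for n
  proof (induction n)
    case 0
    have "compact (\<pi> ` (X \<inter> E))"
      using 0 X by (intro compact_continuous_image continuous_on_subset[OF \<pi>]) auto
    then have "closed (\<pi> ` (X \<inter> E))" by (rule compact_imp_closed)
    moreover have "K 0 y \<inter> E \<noteq> {} \<longleftrightarrow> y \<in> \<pi> ` (X \<inter> E)" for y unfolding K0 by blast
    then have "{y \<in> \<pi> ` X. K 0 y \<inter> E \<noteq> {}} = \<pi> ` X \<inter> \<pi> ` (X \<inter> E)"
      by (simp only: Collect_conj_eq Collect_mem_eq)
    ultimately show ?case by (auto simp: sets_restrict_space)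
  next
    case (Suc n)
    let ?H = "\<lambda>E. {y \<in> \<pi> ` X. K n y \<inter> E \<noteq> {}}"
    have "{y \<in> \<pi> ` X. K (Suc n) y \<inter> E \<noteq> {}} = ?H (C n \<inter> E) \<union> (?H E - ?H (C n))"
      by (auto simp: KS split: if_splits)
    also have "\<dots> \<in> sets (restrict_space borel (\<pi> ` X))"
      by (intro sets.Un sets.Diff Suc.IH closed_Int C Suc.prems)
    finally show ?case .
  qed
  show thesis
  proof
    show "s y \<in> X \<and> \<pi> (s y) = y" if "y \<in> \<pi> ` X" for y using sK[OF that, of 0] by (auto simp: K0)
    show "s y \<in> D" if "y \<in> \<pi> ` (X \<inter> D)" for y
      using that KC[of y _ 0] by (auto simp: K0 C_def)
    have cl: "s -` E \<inter> \<pi> ` X \<in> sets (restrict_space borel (\<pi> ` X))" if E: "closed E" for E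
    proof -
      \<comment> \<open>If all stages meet \<open>E\<close>, they have a common point in
        \<open>E\<close>, and by uniqueness it is \<open>s y\<close>. Hence the preimage of
        \<open>E\<close> is a countable intersection of measurable sets.\<close>
      have "s y \<in> E \<longleftrightarrow> (\<forall>n. K n y \<inter> E \<noteq> {})" if y: "y \<in> \<pi> ` X" for y
      proof
        assume "\<forall>n. K n y \<inter> E \<noteq> {}"
        then have "X \<inter> (\<Inter>n. K n y \<inter> E) \<noteq> {}" using nest E by blast
        then show "s y \<in> E" using uniq[OF y] by blast
      qed (use sK[OF y] in blast)
      then have "s -` E \<inter> \<pi> ` X = (\<Inter>n. {y \<in> \<pi> ` X. K n y \<inter> E \<noteq> {}})" by auto
      also have "\<dots> \<in> sets (restrict_space borel (\<pi> ` X))"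
        by (rule sets.countable_INT') (use meas E in auto)
      finally show ?thesis .
    qed
    have "s \<in> borel_measurable (restrict_space borel (\<pi> ` X))"
    proof (rule borel_measurableI)
      fix S :: "'a set" assume "open S"
      then have "s -` (- S) \<inter> \<pi> ` X \<in> sets (restrict_space borel (\<pi> ` X))" by (intro cl) auto
      then have "space (restrict_space borel (\<pi> ` X)) - (s -` (- S) \<inter> \<pi> ` X) \<in> sets (restrict_space borel (\<pi> ` X))"
        by (rule sets.compl_sets)
      moreover have "space (restrict_space borel (\<pi> ` X)) - (s -` (- S) \<inter> \<pi> ` X)
          = s -` S \<inter> space (restrict_space borel (\<pi> ` X))" by (auto simp: space_restrict_space)
      ultimately show "s -` S \<inter> space (restrict_space borel (\<pi> ` X)) \<in> sets (restrict_space borel (\<pi> ` X))"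
        by simp
    qed
    then show "s \<in> restrict_space borel (\<pi> ` X) \<rightarrow>\<^sub>M restrict_space borel X"
      by (rule measurable_restrict_space2[rotated]) (use sK[of _ 0] in \<open>auto simp: K0 space_restrict_space\<close>)
  qed
qed

section \<open>Lifting measures\<close>

lemma space_borel_prob_measures:
  assumes "\<mu> \<in> borel_prob_measures X" shows "space \<mu> = X"
  using assms sets_eq_imp_space_eq[of \<mu> "restrict_space borel X"]
  by (simp add: borel_prob_measures_def space_restrict_space)

lemma measurable_borel_prob_measures:
  assumes "\<mu> \<in> borel_prob_measures X"
  shows "measurable \<mu> N = measurable (restrict_space borel X) N"
  using assms by (intro measurable_cong_sets) (auto simp: borel_prob_measures_def)

lemma integrable_borel_prob_measures:
  fixes f :: "'a::metric_space \<Rightarrow> real"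
  assumes "\<mu> \<in> borel_prob_measures X" "f \<in> borel_measurable (restrict_space borel X)"
    and "\<And>x. x \<in> X \<Longrightarrow> \<bar>f x\<bar> \<le> B"
  shows "integrable \<mu> f"
proof -
  interpret prob_space \<mu> using assms(1) by (simp add: borel_prob_measures_def)
  show ?thesis
    by (rule integrable_const_bound[where B = B])
      (use assms in \<open>auto simp: measurable_borel_prob_measures[OF assms(1)] space_borel_prob_measures[OF assms(1)]\<close>)
qed

lemma measurable_continuous_on_restrict_space:
  assumes "continuous_on X f" "f ` X \<subseteq> Y"
  shows "f \<in> restrict_space borel X \<rightarrow>\<^sub>M restrict_space borel Y"
  using assms by (intro measurable_restrict_space2 borel_measurable_continuous_on_restrict)
    (auto simp: space_restrict_space)

lemma push_forward_borel_prob_measures: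
  assumes "\<mu> \<in> borel_prob_measures X" "\<pi> \<in> restrict_space borel X \<rightarrow>\<^sub>M restrict_space borel Y"
  shows "push_forward Y \<pi> \<mu> \<in> borel_prob_measures Y"
  using assms prob_space.prob_space_distr[of \<mu> \<pi> "restrict_space borel Y"]
  by (auto simp: borel_prob_measures_def push_forward_def
      measurable_borel_prob_measures[OF assms(1)])

lemma integral_push_forward:
  fixes f :: "'b::metric_space \<Rightarrow> real"
  assumes "\<mu> \<in> borel_prob_measures X" "\<pi> \<in> restrict_space borel X \<rightarrow>\<^sub>M restrict_space borel Y"
    and "f \<in> borel_measurable (restrict_space borel Y)"
  shows "integral\<^sup>L (push_forward Y \<pi> \<mu>) f = (\<integral>x. f (\<pi> x) \<partial>\<mu>)"
  unfolding push_forward_def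
  using assms by (intro integral_distr) (simp_all add: measurable_borel_prob_measures[OF assms(1)])

text \<open>Each \<open>s c y\<close> lies in the fibre over \<open>y\<close>, so distributing the
  mass at \<open>y\<close> over these points with total weight 1 leaves the projection unchanged.
  Weights depending on \<open>y\<close> allow different sections to dominate in different regions of
  \<open>Y\<close>.\<close>

lemma lift_mixture:
  fixes X :: "'a::metric_space set" and Y :: "'b::metric_space set"
    and w :: "'c \<Rightarrow> 'b \<Rightarrow> real" and s :: "'c \<Rightarrow> 'b \<Rightarrow> 'a"
  assumes \<nu>: "\<nu> \<in> borel_prob_measures Y"
    and \<pi>: "\<pi> \<in> restrict_space borel X \<rightarrow>\<^sub>M restrict_space borel Y"
    and F: "finite F"
    and w: "\<And>c. c \<in> F \<Longrightarrow> w c \<in> borel_measurable (restrict_space borel Y)"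
    and w0: "\<And>c y. c \<in> F \<Longrightarrow> y \<in> Y \<Longrightarrow> 0 \<le> w c y"
    and w1: "\<And>y. y \<in> Y \<Longrightarrow> (\<Sum>c\<in>F. w c y) = 1"
    and s: "\<And>c. c \<in> F \<Longrightarrow> s c \<in> restrict_space borel Y \<rightarrow>\<^sub>M restrict_space borel X"
    and \<pi>s: "\<And>c y. c \<in> F \<Longrightarrow> y \<in> Y \<Longrightarrow> \<pi> (s c y) = y"
  obtains \<mu> where "\<mu> \<in> borel_prob_measures X" "push_forward Y \<pi> \<mu> = \<nu>"
    and "\<And>(f :: 'a \<Rightarrow> real) B. f \<in> borel_measurable (restrict_space borel X) \<Longrightarrow>
      (\<And>x. x \<in> X \<Longrightarrow> \<bar>f x\<bar> \<le> B) \<Longrightarrow>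
      integral\<^sup>L \<mu> f = (\<Sum>c\<in>F. \<integral>y. w c y * f (s c y) \<partial>\<nu>)"
proof -
  let ?X = "restrict_space borel X" and ?Y = "restrict_space borel Y"
  interpret \<nu>: prob_space \<nu> using \<nu> by (simp add: borel_prob_measures_def)
  interpret F: finite_measure "count_space F" using F by (rule finite_measure_count_space)
  interpret pair_sigma_finite "count_space F" \<nu> ..
  define P where "P = count_space F \<Otimes>\<^sub>M \<nu>"
  interpret P: finite_measure P
    unfolding P_def by (intro finite_measure_pair_measure) unfold_locales
  have spP: "space P = F \<times> Y"
    by (simp add: P_def space_pair_measure space_borel_prob_measures[OF \<nu>])
  have sets\<nu>: "sets \<nu> = sets ?Y" using \<nu> by (simp add: borel_prob_measures_def)
  define W where "W = (\<lambda>(c, y). w c y)"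
  define S where "S = (\<lambda>(c, y). s c y)"
  have W: "W \<in> borel_measurable P"
    unfolding P_def W_def using F w
    by (intro measurable_pair_measure_countable1)
      (auto simp: countable_finite measurable_borel_prob_measures[OF \<nu>])
  have S: "S \<in> P \<rightarrow>\<^sub>M ?X"
    unfolding P_def S_def using F s
    by (intro measurable_pair_measure_countable1)
      (auto simp: countable_finite measurable_borel_prob_measures[OF \<nu>])
  have snd: "snd \<in> P \<rightarrow>\<^sub>M ?Y"
    unfolding P_def using measurable_snd[of "count_space F" \<nu>] sets\<nu> by (metis measurable_cong_sets)
  (* \<mu> is the image under (c, y) \<mapsto> s c y of the measure on F \<times> Y that picks y by \<nu>
     and then c with probability w c y. *)
  define D where "D = density P W"
  define \<mu> where "\<mu> = distr D ?X S"
  have mD: "measurable D N = measurable P N" for N :: "'d measure"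
    by (rule measurable_cong_sets) (simp_all add: D_def)
  have W0: "0 \<le> W p" if "p \<in> space P" for p
    using w0 that by (auto simp: spP W_def)
  have "push_forward Y \<pi> \<mu> = distr D ?Y (\<pi> \<circ> S)"
    unfolding push_forward_def \<mu>_def using S \<pi> by (subst distr_distr) (auto simp: mD)
  also have "\<dots> = distr D ?Y snd"
    by (rule distr_cong) (use \<pi>s in \<open>auto simp: D_def spP S_def\<close>)
  also have "\<dots> = \<nu>"
  proof (rule measure_eqI)
    fix A assume "A \<in> sets (distr D ?Y snd)"
    then have A: "A \<in> sets ?Y" by simp
    have ind: "indicator A \<in> borel_measurable ?Y" using A by simp
    have "emeasure (distr D ?Y snd) A = emeasure D (snd -` A \<inter> space P)"
      using A snd by (subst emeasure_distr) (auto simp: mD D_def)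
    also have "\<dots> = (\<integral>\<^sup>+p. ennreal (W p) * indicator (snd -` A \<inter> space P) p \<partial>P)"
      unfolding D_def using W snd A by (intro emeasure_density) (auto intro: measurable_sets)
    also have "\<dots> = (\<integral>\<^sup>+p. ennreal (W p) * indicator A (snd p) \<partial>P)"
      by (intro nn_integral_cong) (auto split: split_indicator)
    \<comment> \<open>Tonelli with the sum over \<open>c\<close> inside, where the weights add up to
      1.\<close>
    also have "\<dots> = (\<integral>\<^sup>+y. \<integral>\<^sup>+c. ennreal (W (c, y)) * indicator A (snd (c, y)) \<partial>count_space F \<partial>\<nu>)"
      using W measurable_compose[OF snd ind] unfolding P_def
      by (intro nn_integral_snd[symmetric] borel_measurable_times_ennreal) auto
    also have "\<dots> = (\<integral>\<^sup>+y. indicator A y \<partial>\<nu>)"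
    proof (rule nn_integral_cong)
      fix y assume "y \<in> space \<nu>"
      then have y: "y \<in> Y" by (simp add: space_borel_prob_measures[OF \<nu>])
      have "(\<integral>\<^sup>+c. ennreal (W (c, y)) * indicator A (snd (c, y)) \<partial>count_space F)
          = (\<Sum>c\<in>F. ennreal (w c y)) * indicator A y"
        using F by (simp add: nn_integral_count_space_finite W_def sum_distrib_right)
      also have "(\<Sum>c\<in>F. ennreal (w c y)) = 1"
        using w0 w1[OF y] y by (subst sum_ennreal) auto
      finally show "(\<integral>\<^sup>+c. ennreal (W (c, y)) * indicator A (snd (c, y)) \<partial>count_space F) = indicator A y"
        by simp
    qed
    also have "\<dots> = emeasure \<nu> A" using A sets\<nu> by simp
    finally show "emeasure (distr D ?Y snd) A = emeasure \<nu> A" .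
  qed (use sets\<nu> in simp)
  finally have push: "push_forward Y \<pi> \<mu> = \<nu>" .
  \<comment> \<open>The total mass of \<mu> is read off from its push-forward, the probability
    measure \<nu>.\<close>
  have "\<pi> \<in> \<mu> \<rightarrow>\<^sub>M ?Y" using \<pi> by (simp add: \<mu>_def)
  then have "prob_space \<mu>"
    using push \<nu>.prob_space_axioms unfolding push_forward_def by (metis prob_space_distrD)
  then have \<mu>: "\<mu> \<in> borel_prob_measures X" by (simp add: borel_prob_measures_def \<mu>_def)
  have int: "integral\<^sup>L \<mu> f = (\<Sum>c\<in>F. \<integral>y. w c y * f (s c y) \<partial>\<nu>)"
    if f: "f \<in> borel_measurable ?X" and B: "\<And>x. x \<in> X \<Longrightarrow> \<bar>f x\<bar> \<le> B" for f :: "'a \<Rightarrow> real" and B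
  proof -
    have fS: "(\<lambda>p. f (S p)) \<in> borel_measurable P" by (rule measurable_compose[OF S f])
    have "integral\<^sup>L \<mu> f = (\<integral>p. f (S p) \<partial>D)"
      unfolding \<mu>_def using S f by (intro integral_distr) (auto simp: mD)
    also have "\<dots> = (\<integral>p. W p * f (S p) \<partial>P)"
      unfolding D_def using W W0 fS by (subst integral_density) (auto intro: AE_I2)
    also have "\<dots> = (\<integral>c. \<integral>y. W (c, y) * f (S (c, y)) \<partial>\<nu> \<partial>count_space F)"
      unfolding P_def
    proof (rule integral_fst'[symmetric], fold P_def, rule P.integrable_const_bound[where B = B])
      show "AE p in P. norm (W p * f (S p)) \<le> B"
      proof (rule AE_I2)
        fix p assume p: "p \<in> space P"
        then obtain c y where cy: "p = (c, y)" "c \<in> F" "y \<in> Y" by (auto simp: spP)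
        \<comment> \<open>A nonnegative summand of 1 is at most 1. So \<open>B\<close> bounds the
          integrand, which is therefore integrable over the finite measure \<open>P\<close>, as
          Fubini requires.\<close>
        have "w c y \<le> 1"
          using w1[OF cy(3)] member_le_sum[of c F "\<lambda>c. w c y"] w0 cy F by auto
        moreover have "S p \<in> X"
          using measurable_space[OF S p] by (simp add: space_restrict_space)
        ultimately show "norm (W p * f (S p)) \<le> B"
          using W0[OF p] B[of "S p"] mult_mono[of "W p" 1 "\<bar>f (S p)\<bar>" B] by (simp add: abs_mult W_def cy(1))
      qed
    qed (use W fS in auto)
    also have "\<dots> = (\<Sum>c\<in>F. \<integral>y. w c y * f (s c y) \<partial>\<nu>)"
      using F by (simp add: lebesgue_integral_count_space_finite W_def S_def)
    finally show ?thesis .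
  qed
  show thesis using that \<mu> push int by blast
qed

text \<open>The image of \<nu> under a Borel section of \<pi> lies over \<nu>. It arises from
  \<open>lift_mixture\<close> with a one-point index set and constant weight 1.\<close>

lemma push_forward_surj:
  assumes X: "compact X" and \<pi>: "continuous_on X \<pi>" and Y: "\<pi> ` X = Y"
  shows "push_forward Y \<pi> ` borel_prob_measures X = borel_prob_measures Y"
proof
  have m: "\<pi> \<in> restrict_space borel X \<rightarrow>\<^sub>M restrict_space borel Y"
    using measurable_continuous_on_restrict_space[OF \<pi>] Y by simp
  show "push_forward Y \<pi> ` borel_prob_measures X \<subseteq> borel_prob_measures Y"
    using push_forward_borel_prob_measures[OF _ m] by blast
  obtain s where s: "s \<in> restrict_space borel Y \<rightarrow>\<^sub>M restrict_space borel X"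
    "\<And>y. y \<in> Y \<Longrightarrow> s y \<in> X \<and> \<pi> (s y) = y"
    using measurable_section[OF X \<pi> closed_UNIV] Y by metis
  show "borel_prob_measures Y \<subseteq> push_forward Y \<pi> ` borel_prob_measures X"
  proof
    fix \<nu> assume \<nu>: "\<nu> \<in> borel_prob_measures Y"
    obtain \<mu> where "\<mu> \<in> borel_prob_measures X" "push_forward Y \<pi> \<mu> = \<nu>"
      by (rule lift_mixture[OF \<nu> m, of "{()}" "\<lambda>_ _. 1" "\<lambda>_. s"]) (use s in auto)
    then show "\<nu> \<in> push_forward Y \<pi> ` borel_prob_measures X" by blast
  qed
qed

section \<open>The weak-star topology\<close>

text \<open>Passage to neighbourhoods given by finitely many test functions and one tolerance, by
  induction on how the open set is generated: an intersection merges the test functions and takes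
  the smaller tolerance, and a generator supplies an interval inside its \<open>V\<close>.\<close>

lemma weak_star_nhd:
  assumes "openin (weak_star_topology X) U" "\<mu> \<in> U"
  shows "\<exists>\<F> e. finite \<F> \<and> (\<forall>f\<in>\<F>. continuous_on X f) \<and> (0::real) < e \<and>
    (\<forall>\<mu>'\<in>borel_prob_measures X. (\<forall>f\<in>\<F>. \<bar>integral\<^sup>L \<mu>' f - integral\<^sup>L \<mu> f\<bar> < e) \<longrightarrow> \<mu>' \<in> U)"
  using assms[unfolded weak_star_topology_def openin_topology_generated_by_iff]
proof (induction U)
  case (Int U V)
  obtain \<F> e where F: "finite \<F> \<and> (\<forall>f\<in>\<F>. continuous_on X f) \<and> (0::real) < e \<and>
    (\<forall>\<mu>'\<in>borel_prob_measures X. (\<forall>f\<in>\<F>. \<bar>integral\<^sup>L \<mu>' f - integral\<^sup>L \<mu> f\<bar> < e) \<longrightarrow> \<mu>' \<in> U)"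
    using Int.IH(1)[OF IntD1[OF Int.prems]] by (elim exE)
  obtain \<G> d where G: "finite \<G> \<and> (\<forall>f\<in>\<G>. continuous_on X f) \<and> (0::real) < d \<and>
    (\<forall>\<mu>'\<in>borel_prob_measures X. (\<forall>f\<in>\<G>. \<bar>integral\<^sup>L \<mu>' f - integral\<^sup>L \<mu> f\<bar> < d) \<longrightarrow> \<mu>' \<in> V)"
    using Int.IH(2)[OF IntD2[OF Int.prems]] by (elim exE)
  show ?case
    by (rule exI[of _ "\<F> \<union> \<G>"], rule exI[of _ "min e d"]) (use F G in auto)
next
  case (UN \<K>)
  then obtain V where V: "V \<in> \<K>" "\<mu> \<in> V" by blast
  obtain \<F> e where F: "finite \<F> \<and> (\<forall>f\<in>\<F>. continuous_on X f) \<and> (0::real) < e \<and>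
    (\<forall>\<mu>'\<in>borel_prob_measures X. (\<forall>f\<in>\<F>. \<bar>integral\<^sup>L \<mu>' f - integral\<^sup>L \<mu> f\<bar> < e) \<longrightarrow> \<mu>' \<in> V)"
    using UN.IH[OF V] by (elim exE)
  then show ?case using V(1) by (intro exI[of _ \<F>] exI[of _ e]) auto
next
  case (Basis U)
  then obtain f and V :: "real set" where f: "continuous_on X f" "open V"
    and U: "U = {\<mu> \<in> borel_prob_measures X. integral\<^sup>L \<mu> f \<in> V}" by blast
  with Basis.prems obtain e where "e > 0" "ball (integral\<^sup>L \<mu> f) e \<subseteq> V"
    by (auto elim: openE)
  then show ?case using f(1) unfolding U
    by (intro exI[of _ "{f}"] exI[of _ e]) (auto simp: dist_real_def abs_minus_commute subset_iff)
qed simp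

text \<open>A finite intersection of generators, each taken with the interval
  \<open>ball (a i) e\<close>. The neighbourhood of the discrete measure on \<open>Y\<close> has
  this form.\<close>

lemma openin_weak_star_slab:
  assumes "finite I" and "\<And>i. i \<in> I \<Longrightarrow> continuous_on X (q i)"
  shows "openin (weak_star_topology X)
    {\<mu> \<in> borel_prob_measures X. \<forall>i\<in>I. \<bar>integral\<^sup>L \<mu> (q i) - a i\<bar> < (e::real)}"
  using assms
proof (induction I)
  case empty
  then show ?case using openin_topspace[of "weak_star_topology X"] by simp
next
  case (insert i I)
  have "openin (weak_star_topology X) {\<mu> \<in> borel_prob_measures X. integral\<^sup>L \<mu> (q i) \<in> ball (a i) e}"
    unfolding weak_star_topology_def
    using insert.prems by (intro topology_generated_by_Basis CollectI exI[of _ "q i"] exI[of _ "ball (a i) e"]) auto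
  from openin_Int[OF this insert.IH[OF insert.prems]]
  show ?case by (rule back_subst[of "openin _"])
      (auto simp: dist_real_def abs_minus_commute)
qed

text \<open>By change of variables, the preimage of the generator for \<open>f\<close> and
  \<open>V\<close> is the generator for the composition of \<open>f\<close> with \<pi> and the same
  \<open>V\<close>.\<close>

lemma continuous_map_push_forward:
  assumes \<pi>: "continuous_on X \<pi>" and Y: "\<pi> ` X \<subseteq> Y"
  shows "continuous_map (weak_star_topology X) (weak_star_topology Y) (push_forward Y \<pi>)"
proof -
  note m = measurable_continuous_on_restrict_space[OF \<pi> Y]
  show ?thesis
    unfolding weak_star_topology_def[of Y]
  proof (rule continuous_on_generated_topo)
    fix U assume "U \<in> {{\<mu> \<in> borel_prob_measures Y. integral\<^sup>L \<mu> f \<in> V} | (f :: 'b \<Rightarrow> real) V.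
        continuous_on Y f \<and> open V}"
    then obtain f and V :: "real set" where f: "continuous_on Y f" and V: "open V"
      and U: "U = {\<mu> \<in> borel_prob_measures Y. integral\<^sup>L \<mu> f \<in> V}" by blast
    have "push_forward Y \<pi> -` U \<inter> borel_prob_measures X
        = {\<mu> \<in> borel_prob_measures X. integral\<^sup>L \<mu> (\<lambda>x. f (\<pi> x)) \<in> V}"
      using push_forward_borel_prob_measures[OF _ m] unfolding U
      by (auto simp: integral_push_forward[OF _ m borel_measurable_continuous_on_restrict[OF f]])
    moreover have "continuous_on X (\<lambda>x. f (\<pi> x))" using continuous_on_compose2[OF f \<pi> Y] .
    ultimately show "openin (weak_star_topology X) (push_forward Y \<pi> -` U \<inter> topspace (weak_star_topology X))"
      unfolding topspace_weak_star_topology unfolding weak_star_topology_def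
      using V by (auto intro!: topology_generated_by_Basis)
  next
    show "push_forward Y \<pi> ` topspace (weak_star_topology X) \<subseteq>
        \<Union> {{\<mu> \<in> borel_prob_measures Y. integral\<^sup>L \<mu> f \<in> V} | (f :: 'b \<Rightarrow> real) V.
          continuous_on Y f \<and> open V}"
      unfolding topspace_weak_star_topology[of Y, unfolded weak_star_topology_def topology_generated_by_topspace]
      using push_forward_borel_prob_measures[OF _ m] by auto
  qed
qed

section \<open>Finite approximation\<close>

text \<open>Rounding to a finite net: \<open>r x\<close> is the first point of an enumeration of the
  net that lies within \<open>d\<close> of \<open>x\<close>. Taking the least index resolves ties
  measurably.\<close>

lemma finite_valued_approximation:
  fixes X :: "'a::metric_space set"
  assumes "compact X" "X \<noteq> {}" "d > 0"
  obtains F r where "finite F" "F \<subseteq> X" "F \<noteq> {}" "r \<in> restrict_space borel X \<rightarrow>\<^sub>M count_space F"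
    and "\<And>x. x \<in> X \<Longrightarrow> r x \<in> F \<and> dist x (r x) < d"
proof -
  obtain F where F: "finite F" "F \<subseteq> X" "X \<subseteq> (\<Union>c\<in>F. ball c d)"
    using seq_compact_imp_totally_bounded assms by (metis compact_eq_seq_compact_metric)
  with \<open>X \<noteq> {}\<close> have "F \<noteq> {}" by auto
  define e where "e = from_nat_into F"
  have range_e: "range e = F"
    unfolding e_def by (rule range_from_nat_into[OF \<open>F \<noteq> {}\<close> countable_finite[OF F(1)]])
  define r where "r x = e (LEAST i. dist x (e i) < d)" for x
  have r: "r x \<in> F \<and> dist x (r x) < d" if "x \<in> X" for x
  proof -
    obtain c where c: "c \<in> F" "x \<in> ball c d" using subsetD[OF F(3) \<open>x \<in> X\<close>] by blast
    then obtain i where "c = e i" unfolding range_e[symmetric] by (elim rangeE)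
    with c(2) have "dist x (e i) < d" by (simp add: dist_commute)
    from LeastI[of "\<lambda>i. dist x (e i) < d", OF this] show ?thesis
      unfolding r_def range_e[symmetric] by simp
  qed
  have [measurable]: "(\<lambda>x. dist x c) \<in> borel_measurable (restrict_space borel X)" for c
    by (intro borel_measurable_continuous_on_restrict continuous_intros)
  have "(\<lambda>x. LEAST i. dist x (e i) < d) \<in> restrict_space borel X \<rightarrow>\<^sub>M count_space UNIV"
    by measurable
  moreover have "e \<in> count_space UNIV \<rightarrow>\<^sub>M count_space F" using range_e by auto
  ultimately have "r \<in> restrict_space borel X \<rightarrow>\<^sub>M count_space F"
    unfolding r_def by (rule measurable_compose)
  with that F \<open>F \<noteq> {}\<close> r show thesis by blast
qed

text \<open>A function of \<open>r\<close> is simple, constant on the fibres of \<open>r\<close>.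
  The masses of these fibres become the weights of the discretised measure.\<close>

lemma integral_finite_valued:
  fixes g :: "'c \<Rightarrow> real"
  assumes \<mu>: "\<mu> \<in> borel_prob_measures X" and F: "finite F"
    and r: "r \<in> restrict_space borel X \<rightarrow>\<^sub>M count_space F"
  shows "(\<integral>x. g (r x) \<partial>\<mu>) = (\<Sum>c\<in>F. measure \<mu> (r -` {c} \<inter> X) * g c)"
proof -
  interpret prob_space \<mu> using \<mu> by (simp add: borel_prob_measures_def)
  note sp = space_borel_prob_measures[OF \<mu>]
  have r': "r \<in> \<mu> \<rightarrow>\<^sub>M count_space F" using r by (simp add: measurable_borel_prob_measures[OF \<mu>])
  have sets: "r -` {c} \<inter> X \<in> sets \<mu>" if "c \<in> F" for c
    using measurable_sets[OF r', of "{c}"] that by (simp add: sp)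
  have "(\<integral>x. g (r x) \<partial>\<mu>) = (\<integral>x. (\<Sum>c\<in>F. indicator (r -` {c} \<inter> X) x * g c) \<partial>\<mu>)"
  proof (rule Bochner_Integration.integral_cong)
    fix x assume x: "x \<in> space \<mu>"
    then have "r x \<in> F" using measurable_space[OF r'] by simp
    have "(\<Sum>c\<in>F. indicator (r -` {c} \<inter> X) x * g c) = (\<Sum>c\<in>F. if r x = c then g c else 0)"
      using x by (intro sum.cong) (auto simp: sp)
    also have "\<dots> = g (r x)" using F \<open>r x \<in> F\<close> by simp
    finally show "g (r x) = (\<Sum>c\<in>F. indicator (r -` {c} \<inter> X) x * g c)" by simp
  qed simp
  also have "\<dots> = (\<Sum>c\<in>F. \<integral>x. indicator (r -` {c} \<inter> X) x * g c \<partial>\<mu>)"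
    using sets by (intro Bochner_Integration.integral_sum) (auto intro!: integrable_real_indicator simp: emeasure_eq_measure)
  also have "\<dots> = (\<Sum>c\<in>F. measure \<mu> (r -` {c} \<inter> X) * g c)"
    using sets by (intro sum.cong) (auto simp: sp)
  finally show ?thesis .
qed

text \<open>\<open>q c\<close> detects mass near \<open>y c\<close> on behalf of the index
  \<open>c\<close>. By the last property, the measure with weights \<open>a k\<close> at the points
  \<open>y k\<close> integrates \<open>q c\<close> to exactly \<open>a c\<close>, so the integrals
  of the \<open>q c\<close> define a neighbourhood of that measure.\<close>

lemma tent_functions:
  fixes y :: "'c \<Rightarrow> 'b::metric_space" and a :: "'c \<Rightarrow> real"
  assumes F: "finite F" and W: "\<And>c. c \<in> F \<Longrightarrow> open (W c) \<and> y c \<in> W c"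
    and a: "\<And>c. c \<in> F \<Longrightarrow> 0 \<le> a c"
  obtains q :: "'c \<Rightarrow> 'b \<Rightarrow> real"
  where "\<And>c S. continuous_on S (q c)"
    and "\<And>c z. c \<in> F \<Longrightarrow> 0 \<le> q c z" and "\<And>z. (\<Sum>c\<in>F. q c z) \<le> 1"
    and "\<And>c z. c \<in> F \<Longrightarrow> q c z \<noteq> 0 \<Longrightarrow> z \<in> W c"
    and "\<And>c. c \<in> F \<Longrightarrow> (\<Sum>k\<in>F. a k * q c (y k)) = a c"
proof -
  \<comment> \<open>Radii of at most half the distance to the other points make tents over distinct
    points disjoint.\<close>
  have "\<exists>R>0. ball (y c) R \<subseteq> W c \<and> (\<forall>k\<in>F. y k \<noteq> y c \<longrightarrow> 2 * R \<le> dist (y c) (y k))" if "c \<in> F" for c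
  proof -
    obtain R1 where R1: "R1 > 0" "ball (y c) R1 \<subseteq> W c" using W[OF \<open>c \<in> F\<close>] by (auto simp: open_contains_ball)
    obtain R2 where R2: "R2 > 0" "\<forall>x\<in>y ` F. x \<noteq> y c \<longrightarrow> R2 \<le> dist (y c) x"
      using finite_set_avoid[of "y ` F" "y c"] F by auto
    show ?thesis
      by (rule exI[of _ "min R1 (R2 / 2)"]) (use R1 R2 in force)
  qed
  then obtain R where R: "\<And>c. c \<in> F \<Longrightarrow> R c > 0" "\<And>c. c \<in> F \<Longrightarrow> ball (y c) (R c) \<subseteq> W c"
    "\<And>c k. c \<in> F \<Longrightarrow> k \<in> F \<Longrightarrow> y k \<noteq> y c \<Longrightarrow> 2 * R c \<le> dist (y c) (y k)" by metis
  \<comment> \<open>One radius for all tents; the 1 keeps the set nonempty if \<open>F\<close> is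
    empty.\<close>
  define \<rho> where "\<rho> = Min (insert 1 (R ` F))"
  have \<rho>: "\<rho> > 0" unfolding \<rho>_def using F R(1) by simp
  have \<rho>R: "\<rho> \<le> R c" if "c \<in> F" for c unfolding \<rho>_def using F that by (intro Min_le) auto
  have sep: "2 * \<rho> \<le> dist (y c) (y k)" if "c \<in> F" "k \<in> F" "y k \<noteq> y c" for c k
    using R(3)[OF that] \<rho>R[OF that(1)] by linarith
  (* Equal points y c share a tent, split in the ratio a c : b c; if b c = 0, then a c = 0 and the
     quotient is 0 as well. *)
  define b where "b c = (\<Sum>k | k \<in> F \<and> y k = y c. a k)" for c
  define t where "t c z = max 0 (1 - dist z (y c) / \<rho>)" for c z
  define q where "q c z = a c / b c * t c z" for c z
  have t_nz: "dist z (y c) < \<rho>" if "t c z \<noteq> 0" for c z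
  proof (rule ccontr)
    assume "\<not> dist z (y c) < \<rho>"
    then have "1 \<le> dist z (y c) / \<rho>" using \<rho> by simp
    with that show False by (simp add: t_def)
  qed
  have b: "0 \<le> b c" for c unfolding b_def using a by (intro sum_nonneg) auto
  have b0: "a c = 0" if "b c = 0" "c \<in> F" for c
    using that a member_le_sum[of c "{k \<in> F. y k = y c}" a] F by (fastforce simp: b_def)
  show thesis
  proof
    show "continuous_on S (q c)" for c S
      unfolding q_def t_def by (intro continuous_intros) (use \<rho> in auto)
    show "0 \<le> q c z" if "c \<in> F" for c z unfolding q_def t_def using a[OF that] b[of c] by simp
    show "z \<in> W c" if "c \<in> F" "q c z \<noteq> 0" for c z
    proof -
      have "t c z \<noteq> 0" using that(2) by (auto simp: q_def)
      then show ?thesis using t_nz[of c z] \<rho>R[OF that(1)] R(2)[OF that(1)] by (auto simp: dist_commute)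
    qed
    show "(\<Sum>c\<in>F. q c z) \<le> 1" for z
    \<comment> \<open>Only tents over a single point \<open>y k\<close> can be nonzero at
      \<open>z\<close>, and the shares \<open>a c / b k\<close> of the indices over that point add
      up to at most 1.\<close>
    proof (cases "\<exists>c\<in>F. t c z \<noteq> 0")
      case True
      then obtain k where k: "k \<in> F" "t k z \<noteq> 0" by blast
      have "q c z = (if y c = y k then a c * (t k z / b k) else 0)" if "c \<in> F" for c
      proof (cases "y c = y k")
        case False
        have "t c z = 0"
          using sep[OF that k(1)] False t_nz[OF k(2)] t_nz[of c z] dist_triangle[of "y c" "y k" z]
          by (fastforce simp: dist_commute)
        then show ?thesis using False by (simp add: q_def)
      qed (simp add: q_def t_def b_def)
      then have "(\<Sum>c\<in>F. q c z) = (\<Sum>c\<in>F. if y c = y k then a c * (t k z / b k) else 0)"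
        by simp
      also have "\<dots> = b k * (t k z / b k)"
        using F by (simp only: b_def sum_distrib_right sum.If_cases Int_def mem_Collect_eq sum.neutral_const add_0_right)
      \<comment> \<open>An equality unless \<open>b k = 0\<close>; then the left side is 0 by
        division by zero, and tents are nonnegative.\<close>
      also have "\<dots> \<le> t k z" by (auto simp: t_def)
      also have "\<dots> \<le> 1" using \<rho> by (simp add: t_def)
      finally show ?thesis .
    qed (simp add: q_def)
    show "(\<Sum>k\<in>F. a k * q c (y k)) = a c" if c: "c \<in> F" for c
    proof -
      \<comment> \<open>A tent is 1 at its own point and 0 at the others. So the sum collects the
        weights over \<open>y c\<close>, which total \<open>b c\<close>, and the factor
        \<open>a c / b c\<close> turns this into \<open>a c\<close>.\<close>
      have "t c (y k) = (if y k = y c then 1 else 0)" if "k \<in> F" for k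
      proof (cases "y k = y c")
        case False
        then have "t c (y k) = 0"
          using sep[OF c that] t_nz[of c "y k"] \<rho> by (auto simp: dist_commute)
        with False show ?thesis by simp
      qed (simp add: t_def)
      then have "(\<Sum>k\<in>F. a k * q c (y k)) = (\<Sum>k\<in>F. if y k = y c then a k * (a c / b c) else 0)"
        by (intro sum.cong) (auto simp: q_def)
      also have "\<dots> = b c * (a c / b c)"
        using F by (simp only: b_def sum_distrib_right sum.If_cases Int_def mem_Collect_eq sum.neutral_const add_0_right)
      also have "\<dots> = a c" using b0[OF _ c] by auto
      finally show ?thesis .
    qed
  qed
qed

text \<open>Where \<open>q c\<close> is nonzero, replacing \<open>f c\<close> by \<open>g c\<close>
  costs at most \<open>e\<close>, and these \<open>q c\<close> add up to at most 1. The leftover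
  \<open>1 - sum q F\<close>, spread according to \<open>a\<close>, meets values of size at most
  \<open>M\<close>.\<close>

lemma mixture_pointwise_estimate:
  fixes q a f g :: "'c \<Rightarrow> real"
  assumes q: "\<And>c. c \<in> F \<Longrightarrow> 0 \<le> q c" "sum q F \<le> 1"
    and a: "\<And>c. c \<in> F \<Longrightarrow> 0 \<le> a c" "sum a F = 1"
    and f: "\<And>c. c \<in> F \<Longrightarrow> \<bar>f c\<bar> \<le> M"
    and g: "\<And>c. c \<in> F \<Longrightarrow> q c \<noteq> 0 \<Longrightarrow> \<bar>f c - g c\<bar> \<le> e" and "0 \<le> e"
  shows "\<bar>(\<Sum>c\<in>F. (q c + (1 - sum q F) * a c) * f c) - (\<Sum>c\<in>F. q c * g c)\<bar> \<le> e + M * (1 - sum q F)"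
proof -
  have "(\<Sum>c\<in>F. (q c + (1 - sum q F) * a c) * f c) - (\<Sum>c\<in>F. q c * g c)
      = (\<Sum>c\<in>F. q c * (f c - g c) + (1 - sum q F) * (a c * f c))"
    by (simp add: sum_subtractf[symmetric] algebra_simps)
  also have "\<bar>\<dots>\<bar> \<le> (\<Sum>c\<in>F. q c * e + (1 - sum q F) * (a c * M))"
  proof (rule order_trans[OF sum_abs sum_mono])
    fix c assume c: "c \<in> F"
    \<comment> \<open>The case \<open>q c = 0\<close> is separate because \<open>f c\<close> and
      \<open>g c\<close> need not be close there.\<close>
    have "\<bar>q c * (f c - g c)\<bar> \<le> q c * e"
      using q(1)[OF c] g[OF c] by (cases "q c = 0") (auto simp: abs_mult intro: mult_left_mono)
    moreover have "\<bar>(1 - sum q F) * (a c * f c)\<bar> \<le> (1 - sum q F) * (a c * M)"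
      using q(2) a(1)[OF c] f[OF c] by (auto simp: abs_mult intro!: mult_left_mono)
    ultimately show "\<bar>q c * (f c - g c) + (1 - sum q F) * (a c * f c)\<bar> \<le> q c * e + (1 - sum q F) * (a c * M)"
      by linarith
  qed
  also have "\<dots> = sum q F * e + (1 - sum q F) * (sum a F * M)"
    by (simp add: sum.distrib sum_distrib_left sum_distrib_right)
  also have "\<dots> \<le> e + M * (1 - sum q F)"
    using mult_right_mono[OF q(2) \<open>0 \<le> e\<close>] a(2) by (simp add: mult.commute)
  finally show ?thesis .
qed

text \<open>The pointwise estimate is integrated over \<nu>, then each integral of
  \<open>q c\<close> is replaced by \<open>a c\<close>. Besides \<open>e\<close>, each of the two
  stages costs at most \<open>M * (real (card F) * \<eta>)\<close>: first through the leftover mass,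
  then through the \<open>card F\<close> differences. In the application \<open>g c\<close> is the
  value of \<open>f\<close> at the centre \<open>c\<close>.\<close>

lemma weak_star_mixture_estimate:
  fixes q :: "'c \<Rightarrow> 'b::metric_space \<Rightarrow> real" and f :: "'a::metric_space \<Rightarrow> real"
  assumes \<nu>: "\<nu> \<in> borel_prob_measures Y" and F: "finite F"
    and q: "\<And>c. c \<in> F \<Longrightarrow> q c \<in> borel_measurable (restrict_space borel Y)"
      "\<And>c z. c \<in> F \<Longrightarrow> 0 \<le> q c z" "\<And>z. (\<Sum>c\<in>F. q c z) \<le> 1"
    and a: "\<And>c. c \<in> F \<Longrightarrow> 0 \<le> a c" "sum a F = 1"
    and s: "\<And>c. c \<in> F \<Longrightarrow> s c \<in> restrict_space borel Y \<rightarrow>\<^sub>M restrict_space borel X"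
    and f: "f \<in> borel_measurable (restrict_space borel X)" "\<And>x. x \<in> X \<Longrightarrow> \<bar>f x\<bar> \<le> M"
    and g: "\<And>c. c \<in> F \<Longrightarrow> \<bar>g c\<bar> \<le> M"
      "\<And>c z. c \<in> F \<Longrightarrow> z \<in> Y \<Longrightarrow> q c z \<noteq> 0 \<Longrightarrow> \<bar>f (s c z) - g c\<bar> \<le> e" and "0 \<le> e" "0 \<le> M"
    and \<eta>: "\<And>c. c \<in> F \<Longrightarrow> \<bar>integral\<^sup>L \<nu> (q c) - a c\<bar> \<le> \<eta>"
  shows "\<bar>(\<Sum>c\<in>F. \<integral>z. (q c z + (1 - (\<Sum>k\<in>F. q k z)) * a c) * f (s c z) \<partial>\<nu>) - (\<Sum>c\<in>F. a c * g c)\<bar>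
    \<le> e + 2 * (M * (real (card F) * \<eta>))"
proof -
  interpret prob_space \<nu> using \<nu> by (simp add: borel_prob_measures_def)
  note sp = space_borel_prob_measures[OF \<nu>] and me = measurable_borel_prob_measures[OF \<nu>]
  define Q where "Q z = (\<Sum>c\<in>F. q c z)" for z
  have q1: "q c z \<le> 1" if "c \<in> F" for c z
    by (rule order_trans[OF member_le_sum[of c F "\<lambda>c. q c z"] q(3)[of z]]) (use that q(2) F in auto)
  have Q0: "0 \<le> Q z" for z unfolding Q_def using q(2) by (intro sum_nonneg)
  have Q1: "Q z \<le> 1" for z unfolding Q_def using q(3) .
  have mq: "q c \<in> borel_measurable \<nu>" if "c \<in> F" for c using q(1)[OF that] by (simp add: me)
  have mQ: "Q \<in> borel_measurable \<nu>" unfolding Q_def using mq by (intro borel_measurable_sum)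
  have mfs: "(\<lambda>z. f (s c z)) \<in> borel_measurable \<nu>" if "c \<in> F" for c
    using measurable_compose[OF s[OF that] f(1)] by (simp add: me)
  have fs: "\<bar>f (s c z)\<bar> \<le> M" if "c \<in> F" "z \<in> Y" for c z
    using measurable_space[OF s[OF that(1)], of z] f(2) that(2) by (simp add: space_restrict_space)
  have a1: "a c \<le> 1" if "c \<in> F" for c
    using member_le_sum[of c F a] a F that by (metis DiffD1)
  have iq: "integrable \<nu> (q c)" if "c \<in> F" for c
    by (rule integrable_const_bound[where B = 1]) (use mq q1 q(2) that in auto)
  have iQ: "integrable \<nu> Q" unfolding Q_def using iq by auto
  have iw: "integrable \<nu> (\<lambda>z. (q c z + (1 - Q z) * a c) * f (s c z))" if c: "c \<in> F" for c
  proof (rule integrable_const_bound[where B = "2 * M"])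
    show "AE z in \<nu>. norm ((q c z + (1 - Q z) * a c) * f (s c z)) \<le> 2 * M"
    proof (rule AE_I2)
      fix z assume "z \<in> space \<nu>"
      then have z: "z \<in> Y" by (simp add: sp)
      have "(1 - Q z) * a c \<le> 1 * 1" using Q0[of z] Q1[of z] a(1)[OF c] a1[OF c] by (intro mult_mono) auto
      moreover have "0 \<le> (1 - Q z) * a c" using Q1[of z] a(1)[OF c] by simp
      ultimately have "\<bar>q c z + (1 - Q z) * a c\<bar> \<le> 2" using q1[OF c, of z] q(2)[OF c, of z] by simp
      then show "norm ((q c z + (1 - Q z) * a c) * f (s c z)) \<le> 2 * M"
        using fs[OF c z] by (simp add: abs_mult mult_mono)
    qed
  qed (use mq[OF c] mQ mfs[OF c] in auto)
  \<comment> \<open>\<open>?G\<close> is the integrand produced by the lift; \<open>?H\<close> drops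
    the leftover and freezes the values of \<open>f\<close> at \<open>g c\<close>.\<close>
  let ?G = "\<lambda>z. \<Sum>c\<in>F. (q c z + (1 - Q z) * a c) * f (s c z)"
  let ?H = "\<lambda>z. \<Sum>c\<in>F. q c z * g c"
  have iG: "integrable \<nu> ?G" and iH: "integrable \<nu> ?H"
    using iw iq by (auto intro!: Bochner_Integration.integrable_sum)
  \<comment> \<open>The \<open>a c\<close> add up to 1, so the mass missed by the \<open>q c\<close>
    is the sum of the individual deficits.\<close>
  have sumQ: "1 - integral\<^sup>L \<nu> Q \<le> real (card F) * \<eta>"
  proof -
    have "1 - integral\<^sup>L \<nu> Q = (\<Sum>c\<in>F. a c - integral\<^sup>L \<nu> (q c))"
      unfolding Q_def using iq a(2) by (simp add: Bochner_Integration.integral_sum sum_subtractf)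
    also have "\<dots> \<le> real (card F) * \<eta>" using \<eta> by (intro sum_bounded_above) (auto simp: abs_le_iff)
    finally show ?thesis .
  qed
  have "\<bar>integral\<^sup>L \<nu> ?G - integral\<^sup>L \<nu> ?H\<bar> = \<bar>\<integral>z. ?G z - ?H z \<partial>\<nu>\<bar>"
    using iG iH by simp
  also have "\<dots> \<le> (\<integral>z. \<bar>?G z - ?H z\<bar> \<partial>\<nu>)" by (rule integral_abs_bound)
  also have "\<dots> \<le> (\<integral>z. e + M * (1 - Q z) \<partial>\<nu>)"
  proof (rule integral_mono)
    fix z assume "z \<in> space \<nu>"
    then have z: "z \<in> Y" by (simp add: sp)
    show "\<bar>?G z - ?H z\<bar> \<le> e + M * (1 - Q z)"
      unfolding Q_def by (rule mixture_pointwise_estimate) (use q a fs g z \<open>0 \<le> e\<close> in auto)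
  qed (use iG iH iQ in auto)
  also have "\<dots> = e + M * (1 - integral\<^sup>L \<nu> Q)" using iQ by (simp add: prob_space)
  also have "\<dots> \<le> e + M * (real (card F) * \<eta>)" using sumQ \<open>0 \<le> M\<close> by (simp add: mult_left_mono)
  finally have 1: "\<bar>integral\<^sup>L \<nu> ?G - integral\<^sup>L \<nu> ?H\<bar> \<le> e + M * (real (card F) * \<eta>)" .
  have "\<bar>integral\<^sup>L \<nu> ?H - (\<Sum>c\<in>F. a c * g c)\<bar> = \<bar>\<Sum>c\<in>F. (integral\<^sup>L \<nu> (q c) - a c) * g c\<bar>"
    using iq by (simp add: Bochner_Integration.integral_sum sum_subtractf algebra_simps)
  also have "\<dots> \<le> (\<Sum>c\<in>F. \<eta> * M)"
  proof (rule order_trans[OF sum_abs sum_mono])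
    fix c assume c: "c \<in> F"
    have "0 \<le> \<eta>" using \<eta>[OF c] by linarith
    then show "\<bar>(integral\<^sup>L \<nu> (q c) - a c) * g c\<bar> \<le> \<eta> * M"
      unfolding abs_mult using \<eta>[OF c] g(1)[OF c] by (intro mult_mono) auto
  qed
  finally have 2: "\<bar>integral\<^sup>L \<nu> ?H - (\<Sum>c\<in>F. a c * g c)\<bar> \<le> M * (real (card F) * \<eta>)"
    by (simp add: mult.commute mult.left_commute)
  have "(\<Sum>c\<in>F. \<integral>z. (q c z + (1 - Q z) * a c) * f (s c z) \<partial>\<nu>) = integral\<^sup>L \<nu> ?G"
    using iw by (simp add: Bochner_Integration.integral_sum)
  then show ?thesis unfolding Q_def[symmetric] using 1 2 by linarith
qed

lemma finite_family_bounded_equicontinuous: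
  fixes \<F> :: "('a::metric_space \<Rightarrow> real) set"
  assumes X: "compact X" and "finite \<F>" "\<And>f. f \<in> \<F> \<Longrightarrow> continuous_on X f" and e: "0 < (e::real)"
  obtains M d where "M > 0" "d > 0" "\<And>f x. f \<in> \<F> \<Longrightarrow> x \<in> X \<Longrightarrow> \<bar>f x\<bar> \<le> M"
    and "\<And>f x x'. f \<in> \<F> \<Longrightarrow> x \<in> X \<Longrightarrow> x' \<in> X \<Longrightarrow> dist x x' \<le> d \<Longrightarrow> \<bar>f x - f x'\<bar> \<le> e"
proof -
  have "\<exists>M d. M > 0 \<and> d > 0 \<and> (\<forall>f\<in>\<F>. \<forall>x\<in>X. \<bar>f x\<bar> \<le> M) \<and>
    (\<forall>f\<in>\<F>. \<forall>x\<in>X. \<forall>x'\<in>X. dist x x' \<le> d \<longrightarrow> \<bar>f x - f x'\<bar> \<le> e)"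
    using assms(2,3)
  proof (induction \<F>)
    case empty
    show ?case by (rule exI[of _ 1], rule exI[of _ 1]) simp
  next
    case (insert f \<F>)
    then obtain M d where M: "M > 0" "d > 0" "\<forall>f\<in>\<F>. \<forall>x\<in>X. \<bar>f x\<bar> \<le> M"
      "\<forall>f\<in>\<F>. \<forall>x\<in>X. \<forall>x'\<in>X. dist x x' \<le> d \<longrightarrow> \<bar>f x - f x'\<bar> \<le> e" by auto
    have f: "continuous_on X f" using insert.prems by simp
    obtain B where B: "B > 0" "\<forall>x\<in>X. \<bar>f x\<bar> \<le> B"
      using compact_imp_bounded[OF compact_continuous_image[OF f X]] by (auto simp: bounded_pos)
    obtain d' where d': "d' > 0" "\<forall>x\<in>X. \<forall>x'\<in>X. dist x' x < d' \<longrightarrow> dist (f x') (f x) < e"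
      using compact_uniformly_continuous[OF f X] e unfolding uniformly_continuous_on_def by metis
    \<comment> \<open>Halving \<open>d'\<close> turns the strict bound on distances into a
      non-strict one, which suits sections with values in closed balls.\<close>
    show ?case
    proof (rule exI[of _ "max M B"], rule exI[of _ "min d (d' / 2)"], intro conjI ballI impI)
      fix h x x' assume *: "h \<in> insert f \<F>" "x \<in> X" "x' \<in> X" "dist x x' \<le> min d (d' / 2)"
      then have "dist x x' < d'" using d'(1) by simp
      then have "h = f \<Longrightarrow> \<bar>h x - h x'\<bar> \<le> e"
        using d'(2) * by (metis dist_real_def less_imp_le)
      then show "\<bar>h x - h x'\<bar> \<le> e" using * M(4) by auto
    qed (use M B d'(1) in \<open>auto simp: le_max_iff_disj\<close>)
  qed
  then show thesis using that by metis
qed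

section \<open>Semiopenness\<close>

theorem theorem2p3:
  fixes X :: "'a::metric_space set" and Y :: "'b::metric_space set" and \<pi> :: "'a \<Rightarrow> 'b"
  assumes "compact X" and "compact Y"
    and "continuous_on X \<pi>" and "\<pi> ` X = Y"
    and "semiopen_map (top_of_set X) (top_of_set Y) \<pi>"
  shows "semiopen_map (weak_star_topology X) (weak_star_topology Y) (push_forward Y \<pi>)
    \<and> push_forward Y \<pi> ` borel_prob_measures X = borel_prob_measures Y"
proof (rule conjI)
  have m: "\<pi> \<in> restrict_space borel X \<rightarrow>\<^sub>M restrict_space borel Y"
    using measurable_continuous_on_restrict_space[of X \<pi> Y] assms by simp
  show "push_forward Y \<pi> ` borel_prob_measures X = borel_prob_measures Y"
    using push_forward_surj assms by blast
  show "semiopen_map (weak_star_topology X) (weak_star_topology Y) (push_forward Y \<pi>)"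
    unfolding semiopen_map_def
  proof (intro conjI allI impI)
    show "continuous_map (weak_star_topology X) (weak_star_topology Y) (push_forward Y \<pi>)"
      using continuous_map_push_forward assms by blast
    fix U assume U: "openin (weak_star_topology X) U \<and> U \<noteq> {}"
    then obtain \<mu>0 where "\<mu>0 \<in> U" by blast
    with U have \<mu>0: "\<mu>0 \<in> borel_prob_measures X"
      using openin_subset by fastforce
    then interpret \<mu>0: prob_space \<mu>0 by (simp add: borel_prob_measures_def)
    note sp0 = space_borel_prob_measures[OF \<mu>0]
    have "X \<noteq> {}" using \<mu>0.not_empty sp0 by simp
    obtain \<F> e where nhd: "finite \<F> \<and> (\<forall>f\<in>\<F>. continuous_on X f) \<and> (0::real) < e \<and>
      (\<forall>\<mu>\<in>borel_prob_measures X. (\<forall>f\<in>\<F>. \<bar>integral\<^sup>L \<mu> f - integral\<^sup>L \<mu>0 f\<bar> < e) \<longrightarrow> \<mu> \<in> U)"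
      using weak_star_nhd[OF conjunct1[OF U] \<open>\<mu>0 \<in> U\<close>] by (elim exE)
    then have \<F>: "finite \<F>" "\<And>f. f \<in> \<F> \<Longrightarrow> continuous_on X f" and e: "0 < e" by auto
    have inU: "\<mu> \<in> U" if "\<mu> \<in> borel_prob_measures X"
      "\<And>f. f \<in> \<F> \<Longrightarrow> \<bar>integral\<^sup>L \<mu> f - integral\<^sup>L \<mu>0 f\<bar> < e" for \<mu>
      using nhd that by blast
    \<comment> \<open>Error budget: \<open>e / 4\<close> for the oscillation of \<open>f\<close>
      near the centres, \<open>e / 4\<close> for the two mass errors, \<open>e / 4\<close> for
      discretising \<open>\<mu>0\<close>. The total stays below \<open>e\<close>.\<close>
    obtain M d where M: "M > 0" "\<And>f x. f \<in> \<F> \<Longrightarrow> x \<in> X \<Longrightarrow> \<bar>f x\<bar> \<le> M"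
      and d: "d > 0" "\<And>f x x'. f \<in> \<F> \<Longrightarrow> x \<in> X \<Longrightarrow> x' \<in> X \<Longrightarrow> dist x x' \<le> d \<Longrightarrow> \<bar>f x - f x'\<bar> \<le> e / 4"
      using finite_family_bounded_equicontinuous[OF \<open>compact X\<close> \<F>, of "e / 4"] e
      by (metis divide_pos_pos zero_less_numeral)
    obtain F r where F: "finite F" "F \<subseteq> X" "F \<noteq> {}"
      and r: "r \<in> restrict_space borel X \<rightarrow>\<^sub>M count_space F"
        "\<And>x. x \<in> X \<Longrightarrow> r x \<in> F \<and> dist x (r x) < d"
      using finite_valued_approximation[OF \<open>compact X\<close> \<open>X \<noteq> {}\<close> d(1)] by metis
    define a where "a c = measure \<mu>0 (r -` {c} \<inter> X)" for c
    have a0: "0 \<le> a c" for c by (simp add: a_def)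
    have int_r: "(\<integral>x. g (r x) \<partial>\<mu>0) = (\<Sum>c\<in>F. a c * g c)" for g :: "'a \<Rightarrow> real"
      unfolding a_def by (rule integral_finite_valued[OF \<mu>0 F(1) r(1)])
    have a1: "sum a F = 1" using int_r[of "\<lambda>_. 1"] by (simp add: \<mu>0.prob_space)
    \<comment> \<open>Semiopenness applied to the part of \<open>X\<close> in
      \<open>ball c d\<close>. The point \<open>y c\<close> is any point of the resulting interior;
      the image of \<open>c\<close> itself need not lie there.\<close>
    have "\<exists>y V. open V \<and> y \<in> V \<and> y \<in> Y \<and> Y \<inter> V \<subseteq> \<pi> ` (X \<inter> ball c d)" if "c \<in> F" for c
    proof -
      have "openin (top_of_set X) (X \<inter> ball c d)" "X \<inter> ball c d \<noteq> {}"
        using F(2) that d(1) by (auto simp: openin_open_Int)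
      then have ne: "top_of_set Y interior_of (\<pi> ` (X \<inter> ball c d)) \<noteq> {}"
        using assms(5) unfolding semiopen_map_def by blast
      obtain V where "open V" "top_of_set Y interior_of (\<pi> ` (X \<inter> ball c d)) = Y \<inter> V"
        using openin_interior_of[of "top_of_set Y"] unfolding openin_open by blast
      then show ?thesis
        using ne interior_of_subset[of "top_of_set Y" "\<pi> ` (X \<inter> ball c d)"] by blast
    qed
    then obtain y V where V: "\<And>c. c \<in> F \<Longrightarrow> open (V c) \<and> y c \<in> V c"
      and yY: "\<And>c. c \<in> F \<Longrightarrow> y c \<in> Y" and VY: "\<And>c. c \<in> F \<Longrightarrow> Y \<inter> V c \<subseteq> \<pi> ` (X \<inter> ball c d)"
      by metis
    obtain q :: "'a \<Rightarrow> 'b \<Rightarrow> real" where q: "\<And>c S. continuous_on S (q c)"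
      "\<And>c z. c \<in> F \<Longrightarrow> 0 \<le> q c z" "\<And>z. (\<Sum>c\<in>F. q c z) \<le> 1"
      "\<And>c z. c \<in> F \<Longrightarrow> q c z \<noteq> 0 \<Longrightarrow> z \<in> V c"
      "\<And>c. c \<in> F \<Longrightarrow> (\<Sum>k\<in>F. a k * q c (y k)) = a c"
      by (rule tent_functions[where F = F and W = V and y = y and a = a, OF F(1)])
        (erule V, rule a0, (rule that; assumption))
    note mq = borel_measurable_continuous_on_restrict[OF q(1)]
    \<comment> \<open>Closed balls, because the preferred set of \<open>measurable_section\<close>
      has to be closed. Each section is defined on all of \<open>Y\<close>, so it can also carry a
      share of the leftover mass.\<close>
    have "\<exists>s. s \<in> restrict_space borel Y \<rightarrow>\<^sub>M restrict_space borel X \<and>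
        (\<forall>z\<in>Y. s z \<in> X \<and> \<pi> (s z) = z) \<and> (\<forall>z\<in>\<pi> ` (X \<inter> cball c d). s z \<in> cball c d)" for c
      by (rule measurable_section[OF assms(1,3) closed_cball[of c d]]) (use assms(4) in blast)
    then obtain s where s: "\<And>c. s c \<in> restrict_space borel Y \<rightarrow>\<^sub>M restrict_space borel X"
      "\<And>c z. z \<in> Y \<Longrightarrow> s c z \<in> X \<and> \<pi> (s c z) = z"
      "\<And>c z. z \<in> \<pi> ` (X \<inter> cball c d) \<Longrightarrow> s c z \<in> cball c d" by metis
    have near: "dist (s c z) c \<le> d" if "c \<in> F" "z \<in> Y" "q c z \<noteq> 0" for c z
    proof -
      have "z \<in> \<pi> ` (X \<inter> ball c d)" using q(4) VY that by blast
      then have "z \<in> \<pi> ` (X \<inter> cball c d)" using ball_subset_cball by blast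
      then show ?thesis using s(3)[of z c] by (simp add: dist_commute)
    qed
    \<comment> \<open>Chosen so that each of the two mass errors is at most
      \<open>e / 8\<close>.\<close>
    define \<eta> where "\<eta> = e / (8 * (M * real (card F)))"
    have cardF: "0 < real (card F)" using F by (simp add: card_gt_0_iff)
    have \<eta>: "\<eta> > 0" unfolding \<eta>_def using e M(1) cardF by simp
    have M\<eta>: "M * (real (card F) * \<eta>) = e / 8" unfolding \<eta>_def using M(1) cardF by simp
    define \<V> where "\<V> = {\<nu> \<in> borel_prob_measures Y. \<forall>c\<in>F. \<bar>integral\<^sup>L \<nu> (q c) - a c\<bar> < \<eta>}"
    have "openin (weak_star_topology Y) \<V>"
      unfolding \<V>_def by (rule openin_weak_star_slab[OF F(1) q(1)])
    \<comment> \<open>The discrete measure with weights \<open>a c\<close> at the points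
      \<open>y c\<close> belongs to \<open>\<V>\<close>. It is realised as the law of
      \<open>y (r x)\<close> under \<open>\<mu>0\<close>.\<close>
    moreover have "\<V> \<noteq> {}"
    proof -
      have "y \<in> count_space F \<rightarrow>\<^sub>M restrict_space borel Y"
        using yY by (auto simp: space_restrict_space)
      then have yr: "(\<lambda>x. y (r x)) \<in> \<mu>0 \<rightarrow>\<^sub>M restrict_space borel Y"
        using measurable_compose[OF r(1)] by (simp add: measurable_borel_prob_measures[OF \<mu>0])
      let ?\<nu> = "distr \<mu>0 (restrict_space borel Y) (\<lambda>x. y (r x))"
      have "integral\<^sup>L ?\<nu> (q c) = a c" if "c \<in> F" for c
        using integral_distr[OF yr mq, of c] int_r[of "\<lambda>x. q c (y x)"] q(5)[OF that] by simp
      moreover have "?\<nu> \<in> borel_prob_measures Y"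
        using \<mu>0.prob_space_distr[OF yr] by (simp add: borel_prob_measures_def)
      ultimately show ?thesis using \<eta> unfolding \<V>_def by fastforce
    qed
    moreover have "\<V> \<subseteq> push_forward Y \<pi> ` U"
    proof
      fix \<nu> assume "\<nu> \<in> \<V>"
      then have \<nu>: "\<nu> \<in> borel_prob_measures Y" "\<And>c. c \<in> F \<Longrightarrow> \<bar>integral\<^sup>L \<nu> (q c) - a c\<bar> < \<eta>"
        by (auto simp: \<V>_def)
      \<comment> \<open>Near \<open>y c\<close> the section \<open>s c\<close> gets the weight
        \<open>q c\<close>; whatever the \<open>q k\<close> leave over is shared in the proportions
        \<open>a c\<close>, which restores total weight 1.\<close>
      let ?w = "\<lambda>c z. q c z + (1 - (\<Sum>k\<in>F. q k z)) * a c"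
      have w1: "(\<Sum>c\<in>F. ?w c z) = 1" for z
        by (simp add: sum.distrib sum_distrib_left[symmetric] a1)
      have w0: "0 \<le> ?w c z" if "c \<in> F" for c z
        using q(2)[OF that] q(3)[of z] a0[of c] by simp
      obtain \<mu> where \<mu>: "\<mu> \<in> borel_prob_measures X" "push_forward Y \<pi> \<mu> = \<nu>"
        and int\<mu>: "\<And>(f :: 'a \<Rightarrow> real) B. f \<in> borel_measurable (restrict_space borel X) \<Longrightarrow>
          (\<And>x. x \<in> X \<Longrightarrow> \<bar>f x\<bar> \<le> B) \<Longrightarrow> integral\<^sup>L \<mu> f = (\<Sum>c\<in>F. \<integral>z. ?w c z * f (s c z) \<partial>\<nu>)"
      proof (rule lift_mixture[OF \<nu>(1) m F(1), of ?w s])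
        show "?w c \<in> borel_measurable (restrict_space borel Y)" for c
          using mq by (intro borel_measurable_add borel_measurable_times borel_measurable_diff
              borel_measurable_sum borel_measurable_const)
      qed (use w0 w1 s in auto)
      have "\<mu> \<in> U"
      proof (rule inU[OF \<mu>(1)])
        fix f assume f: "f \<in> \<F>"
        note mf = borel_measurable_continuous_on_restrict[OF \<F>(2)[OF f]]
        have \<mu>_eq: "integral\<^sup>L \<mu> f = (\<Sum>c\<in>F. \<integral>z. ?w c z * f (s c z) \<partial>\<nu>)"
          by (rule int\<mu>[OF mf M(2)[OF f]])
        have "\<bar>integral\<^sup>L \<mu> f - (\<Sum>c\<in>F. a c * f c)\<bar> \<le> e / 4 + 2 * (M * (real (card F) * \<eta>))"
          unfolding \<mu>_eq
        proof (rule weak_star_mixture_estimate[where X = X, OF \<nu>(1) F(1) mq])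
          show "\<bar>f (s c z) - f c\<bar> \<le> e / 4" if "c \<in> F" "z \<in> Y" "q c z \<noteq> 0" for c z
            using d(2)[OF f _ _ near[OF that]] s(2) F(2) that by blast
          show "\<bar>f c\<bar> \<le> M" if "c \<in> F" for c using M(2)[OF f] F(2) that by blast
          show "\<bar>integral\<^sup>L \<nu> (q c) - a c\<bar> \<le> \<eta>" if "c \<in> F" for c using \<nu>(2)[OF that] by simp
        qed (use e M q(2,3) a0 a1 s(1) mf f in auto)
        \<comment> \<open>Rounding by \<open>r\<close> moves each point by less than
          \<open>d\<close>, hence changes \<open>f\<close> by at most \<open>e / 4\<close>.\<close>
        moreover have "\<bar>integral\<^sup>L \<mu>0 f - (\<Sum>c\<in>F. a c * f c)\<bar> \<le> e / 4"
        proof -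
          have rX: "r \<in> restrict_space borel X \<rightarrow>\<^sub>M restrict_space borel X"
            by (rule measurable_compose[OF r(1), of "\<lambda>x. x"])
              (use F(2) in \<open>auto simp: space_restrict_space\<close>)
          have i1: "integrable \<mu>0 f" by (rule integrable_borel_prob_measures[OF \<mu>0 mf M(2)[OF f]])
          have i2: "integrable \<mu>0 (\<lambda>x. f (r x))"
            by (rule integrable_borel_prob_measures[OF \<mu>0 measurable_compose[OF rX mf] M(2)[OF f]])
              (use r(2) F(2) in blast)
          have "\<bar>integral\<^sup>L \<mu>0 f - (\<Sum>c\<in>F. a c * f c)\<bar> = \<bar>\<integral>x. f x - f (r x) \<partial>\<mu>0\<bar>"
            using i1 i2 by (simp add: int_r)
          also have "\<dots> \<le> (\<integral>x. \<bar>f x - f (r x)\<bar> \<partial>\<mu>0)" by (rule integral_abs_bound)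
          also have "\<dots> \<le> (\<integral>x. e / 4 \<partial>\<mu>0)"
          proof (rule integral_mono)
            fix x assume "x \<in> space \<mu>0"
            then show "\<bar>f x - f (r x)\<bar> \<le> e / 4"
              using d(2)[OF f] r(2)[of x] F(2) by (auto simp: sp0)
          qed (use i1 i2 in auto)
          finally show ?thesis by (simp add: \<mu>0.prob_space)
        qed
        ultimately show "\<bar>integral\<^sup>L \<mu> f - integral\<^sup>L \<mu>0 f\<bar> < e" using M\<eta> e by linarith
      qed
      with \<mu>(2) show "\<nu> \<in> push_forward Y \<pi> ` U" by blast
    qed
    ultimately show "weak_star_topology Y interior_of (push_forward Y \<pi> ` U) \<noteq> {}"
      using interior_of_maximal by blast
  qed
qed

end
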